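(* Let $a\in\mathbb{N}$ with $a\geq 3$ and let $S=\langle a,a+1,a+2\rangle$. Define $\mathscr{L}_a=\lfloor a/2\rfloor (a+2)$ if $a$ is even, and $\mathscr{L}_a=(\lfloor a/2\rfloor+2)a$ if $a$ is odd. Then $S\cap \llbracket 0,\mathscr{L}_a)\!)\subseteq \operatorname{ULF}(S)$ and $\mathscr{L}_a\notin \operatorname{ULF}(S)$. Moreover, for every $r\in S\cap\llbracket 0,\mathscr{L}_a)\!)$ one has $\operatorname{L}(r,S)=\{\lfloor r/a\rfloor\}$.
   Context: $\mathbb{N}=\{0,1,2,\dots\}$. $S=\langle a,a+1,a+2\rangle=\{\alpha_1a+\alpha_2(a+1)+\alpha_3(a+2):\alpha_i\in\mathbb{N}\}$. For $r\in\mathbb{N}$, the set of factorizations of $r$ is $\operatorname{F}(r,S)=\{\alpha\in\mathbb{N}^3:\alpha_1a+\alpha_2(a+1)+\alpha_3(a+2)=r\}$; the length of $\alpha$ is $|\alpha|=\alpha_1+\alpha_2+\alpha_3$; $\operatorname{L}(r,S)=\{|\alpha|:\alpha\in\operatorname{F}(r,S)\}$; and $\operatorname{ULF}(S)=\{r\in S:\operatorname{L}(r,S)\text{ has exactly one element}\}$. For integers $x,y$, $\llbracket x,y)\!)=\{n\in\mathbb{Z}:x\le n<y\}$. *)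

theory Defs
  imports Main
begin

definition semigroup3 :: "nat \<Rightarrow> nat set" where
  "semigroup3 a = {\<alpha>1 * a + \<alpha>2 * (a + 1) + \<alpha>3 * (a + 2) | \<alpha>1 \<alpha>2 \<alpha>3. True}"

text \<open>The sets \<open>F(r,S)\<close>, \<open>L(r,S)\<close> and \<open>ULF(S)\<close> for \<open>S = semigroup3 a\<close> are indexed by \<open>a\<close>,
  since factorizations refer to the generators \<open>a, a+1, a+2\<close>.\<close>

definition factorizations :: "nat \<Rightarrow> nat \<Rightarrow> (nat \<times> nat \<times> nat) set" where
  "factorizations r a =
     {(\<alpha>1, \<alpha>2, \<alpha>3). \<alpha>1 * a + \<alpha>2 * (a + 1) + \<alpha>3 * (a + 2) = r}"

definition fact_length :: "nat \<times> nat \<times> nat \<Rightarrow> nat" where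
  "fact_length = (\<lambda>(\<alpha>1, \<alpha>2, \<alpha>3). \<alpha>1 + \<alpha>2 + \<alpha>3)"

definition lengths :: "nat \<Rightarrow> nat \<Rightarrow> nat set" where
  "lengths r a = fact_length ` factorizations r a"

definition ULF :: "nat \<Rightarrow> nat set" where
  "ULF a = {r \<in> semigroup3 a. \<exists>!l. l \<in> lengths r a}"

definition ulf_bound :: "nat \<Rightarrow> nat" where
  "ulf_bound a = (if even a then (a div 2) * (a + 2) else (a div 2 + 2) * a)"

end

theory Submission
  imports Defs
begin

text \<open>A factorization of \<open>r\<close> of length \<open>l\<close> forces \<open>l * a \<le> r \<le> l * (a + 2)\<close>. Below the bound,
  either \<open>2 * l < a\<close>, or \<open>(l + 1) * a\<close> is the bound itself; in both cases \<open>r < (l + 1) * a\<close>,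
  so \<open>l = r div a\<close>. At the bound two consecutive lengths occur.\<close>

lemma lengths_iff:
  "l \<in> lengths r a \<longleftrightarrow>
    (\<exists>x y z. x * a + y * (a + 1) + z * (a + 2) = r \<and> l = x + y + z)"
  by (force simp: lengths_def factorizations_def fact_length_def)

lemma semigroup3_iff: "r \<in> semigroup3 a \<longleftrightarrow> lengths r a \<noteq> {}"
  by (auto simp: semigroup3_def lengths_def factorizations_def)

text \<open>Each of the \<open>l\<close> summands exceeds \<open>a\<close> by 0, 1 or 2, so the
  total excess over \<open>l * a\<close> is at most \<open>2 * l\<close>.\<close>

lemma lengths_bounds:
  assumes "l \<in> lengths r a"
  shows "l * a \<le> r" and "r \<le> l * a + 2 * l"
  using assms by (auto simp: lengths_iff algebra_simps)

lemma length_eq_div: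
  assumes l: "l \<in> lengths r a" and r: "r < ulf_bound a"
  shows "l = r div a"
proof -
  \<comment> \<open>\<open>m\<close> is a/2 rounded up. This makes \<open>l < m\<close> equivalent
    to \<open>2 * l < a\<close>, and the bound equals \<open>(m + 1) * a\<close> for both
    parities.\<close>
  define m where "m = (if even a then a div 2 else a div 2 + 1)"
  have bound: "ulf_bound a = (m + 1) * a"
    by (auto simp: ulf_bound_def m_def algebra_simps elim!: evenE)
  with lengths_bounds(1)[OF l] r have "l * a < (m + 1) * a"
    by linarith
  then have "l \<le> m"
    using mult_less_cancel2[of l a "m + 1"] by simp
  have "r < (l + 1) * a"
  proof (cases "l = m")
    case True
    then show ?thesis using r bound by simp
  next
    case False
    with \<open>l \<le> m\<close> have "2 * l < a"
      unfolding m_def by (cases "even a") (auto elim!: evenE oddE)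
    then show ?thesis using lengths_bounds(2)[OF l] by simp
  qed
  with lengths_bounds(1)[OF l] show ?thesis
    by (intro div_nat_eqI[symmetric]) (simp_all add: mult.commute)
qed

lemma ulf_bound_not_in_ULF: "ulf_bound a \<notin> ULF a"
proof -
  have "\<exists>l. l \<in> lengths (ulf_bound a) a \<and> l + 1 \<in> lengths (ulf_bound a) a"
  proof (cases "even a")
    case True
    then obtain k where k: "a = 2 * k" by (elim evenE)
    \<comment> \<open>The witnesses are \<open>(0, 0, k)\<close> here and
      \<open>(k + 1, 0, 0)\<close> below: as \<open>2 * k = a\<close>, the excess of
      \<open>k\<close> copies of \<open>a + 2\<close> makes up one more \<open>a\<close>.\<close>
    have "k \<in> lengths (ulf_bound a) a"
      unfolding lengths_iff
      by (intro exI[of _ 0] exI[of _ k]) (simp add: ulf_bound_def k)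
    moreover have "k + 1 \<in> lengths (ulf_bound a) a"
      unfolding lengths_iff
      by (intro exI[of _ "k + 1"] exI[of _ 0]) (simp add: ulf_bound_def k)
    ultimately show ?thesis by blast
  next
    case False
    then obtain k where k: "a = 2 * k + 1" by (elim oddE)
    \<comment> \<open>The summands \<open>a + 1\<close> and \<open>k\<close> copies of
      \<open>a + 2\<close> have total excess \<open>1 + 2 * k = a\<close>, which again makes up one
      more \<open>a\<close>.\<close>
    have "k + 1 \<in> lengths (ulf_bound a) a"
      unfolding lengths_iff
      by (rule exI[of _ 0], rule exI[of _ 1], rule exI[of _ k])
        (simp add: ulf_bound_def k algebra_simps)
    moreover have "k + 1 + 1 \<in> lengths (ulf_bound a) a"
      unfolding lengths_iff
      by (rule exI[of _ "k + 2"], rule exI[of _ 0], rule exI[of _ 0])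
        (simp add: ulf_bound_def k)
    ultimately show ?thesis by blast
  qed
  then obtain l where "l \<in> lengths (ulf_bound a) a" "l + 1 \<in> lengths (ulf_bound a) a"
    by blast
  moreover have "l \<noteq> l + 1" by simp
  ultimately show ?thesis
    unfolding ULF_def by blast
qed

theorem theorem2p2:
  fixes a :: nat
  assumes "a \<ge> 3"
  shows "semigroup3 a \<inter> {0..<ulf_bound a} \<subseteq> ULF a
    \<and> ulf_bound a \<notin> ULF a
    \<and> (\<forall>r \<in> semigroup3 a \<inter> {0..<ulf_bound a}. lengths r a = {r div a})"
proof -
  \<comment> \<open>Membership in the semigroup gives some length; \<open>length_eq_div\<close>
    leaves only \<open>r div a\<close>.\<close>
  have L: "lengths r a = {r div a}" if "r \<in> semigroup3 a \<inter> {0..<ulf_bound a}" for r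
    using that length_eq_div[of _ r a] by (auto simp: semigroup3_iff)
  then have "semigroup3 a \<inter> {0..<ulf_bound a} \<subseteq> ULF a"
    unfolding ULF_def by auto
  with L show ?thesis
    using ulf_bound_not_in_ULF by blast
qed

end
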